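(* Consider the Q-TCSS (quantum threshold changeable secret sharing) scheme, in which a pure qubit secret $a|0\rangle + b|1\rangle$ (with $a,b\in\mathbb{C}$, $|a|^2+|b|^2=1$) is currently shared among $n$ parties as the $n$-qubit state $a|00\dots0\rangle + b|11\dots1\rangle$, each party holding one qubit. The current threshold is $n$, the number of all parties at this time. Then the quantum secret cannot be recovered if the number of participating parties is less than the current threshold $n$.
   Context: In the Q-TCSS scheme, the quantum secret is a pure qubit state $a|0\rangle + b|1\rangle$ with $|a|^2+|b|^2=1$. A holder of one qubit of the shared state may split its share further by appending any number of auxiliary qubits in state $|0\rangle$, applying controlled-NOT gates with the held qubit as control and each auxiliary qubit as target, and sending the newly entangled qubits to new parties. This increases the number of parties, and hence the threshold. Whenever the current total number of parties is $n$, the parties jointly hold the pure state $a|00\dots0\rangle + b|11\dots1\rangle$ on $n$ qubits, one qubit per party. When all $n$ parties put their qubits together, this state can be transformed back to the secret $a|0\rangle+b|1\rangle$. When only some of the parties participate, the state they hold together is the reduced density operator $\rho$ obtained from the shared state by tracing out the qubits of the missing parties. No formal definition of "recovered" is given. Non-recoverability is understood in the following sense: the state $\rho$ that the participating parties put together is mixed (with $\mathrm{Tr}(\rho^2)=|a|^4+|b|^4<1$ if $a\neq 0$ and $b\neq 0$), while the original quantum secret is pure, hence the pure secret state cannot be recovered. *)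

theory Defs
  imports "Jordan_Normal_Form.Schur_Decomposition"
begin

text \<open>
  The parties are \<open>0, \<dots>, n - 1\<close>, and operators on their \<open>n\<close> qubits are
  \<open>2 ^ n \<times> 2 ^ n\<close> matrices over the computational basis: the basis vector with index \<open>u\<close>
  is the one in which the qubit of party \<open>p\<close> has the value of the binary digit \<open>bit u p\<close>.
  So \<open>|00\<dots>0\<rangle>\<close> has index \<open>0\<close> and \<open>|11\<dots>1\<rangle>\<close> has index \<open>2 ^ n - 1\<close>.
\<close>

definition secret :: "complex \<Rightarrow> complex \<Rightarrow> complex vec" where
  "secret a b = a \<cdot>\<^sub>v unit_vec 2 0 + b \<cdot>\<^sub>v unit_vec 2 1"

definition shared_state :: "nat \<Rightarrow> complex \<Rightarrow> complex \<Rightarrow> complex vec" where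
  "shared_state n a b =
     a \<cdot>\<^sub>v unit_vec (2 ^ n) 0 + b \<cdot>\<^sub>v unit_vec (2 ^ n) (2 ^ n - 1)"

text \<open>\<open>|v\<rangle>\<langle>v|\<close>\<close>

definition projector :: "complex vec \<Rightarrow> complex mat" where
  "projector v = mat (dim_vec v) (dim_vec v) (\<lambda>(i, j). v $ i * conjugate (v $ j))"

definition mat_trace :: "complex mat \<Rightarrow> complex" where
  "mat_trace A = sum_list (diag_mat A)"

definition density_operator :: "nat \<Rightarrow> complex mat \<Rightarrow> bool" where
  "density_operator d \<rho> \<longleftrightarrow>
     \<rho> \<in> carrier_mat d d \<and> mat_adjoint \<rho> = \<rho> \<and>
     (\<forall>v \<in> carrier_vec d. 0 \<le> (\<rho> *\<^sub>v v) \<bullet>c v) \<and> mat_trace \<rho> = 1"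

definition pure_state :: "nat \<Rightarrow> complex mat \<Rightarrow> bool" where
  "pure_state d \<rho> \<longleftrightarrow> (\<exists>v \<in> carrier_vec d. v \<bullet>c v = 1 \<and> \<rho> = projector v)"

definition mixed_state :: "nat \<Rightarrow> complex mat \<Rightarrow> bool" where
  "mixed_state d \<rho> \<longleftrightarrow> density_operator d \<rho> \<and> \<not> pure_state d \<rho>"

text \<open>
  For a set \<open>S\<close> of parties, the \<open>card S\<close> qubits held by \<open>S\<close> are numbered in increasing order of
  the parties; \<open>restricts_to S u x\<close> says that \<open>x\<close> is the part of the basis index \<open>u\<close>
  that belongs to \<open>S\<close>.
\<close>

definition restricts_to :: "nat set \<Rightarrow> nat \<Rightarrow> nat \<Rightarrow> bool" where
  "restricts_to S u x \<longleftrightarrow> (\<forall>j < card S. bit x j \<longleftrightarrow> bit u (sorted_list_of_set S ! j))"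

text \<open>
  The partial trace over the qubits of the parties outside \<open>S\<close>: the entry at \<open>(x, y)\<close> sums the
  entries of \<open>\<rho>\<close> at those \<open>(u, v)\<close> that extend \<open>(x, y)\<close> and agree on all traced-out qubits.
\<close>

definition reduced_state :: "nat \<Rightarrow> nat set \<Rightarrow> complex mat \<Rightarrow> complex mat" where
  "reduced_state n S \<rho> = mat (2 ^ card S) (2 ^ card S) (\<lambda>(x, y).
     \<Sum>(u, v) \<in> {(u, v). u < 2 ^ n \<and> v < 2 ^ n \<and> restricts_to S u x \<and> restricts_to S v y \<and>
                       (\<forall>p \<in> {..<n} - S. bit u p \<longleftrightarrow> bit v p)}. \<rho> $$ (u, v))"

definition held_state :: "nat \<Rightarrow> nat set \<Rightarrow> complex \<Rightarrow> complex \<Rightarrow> complex mat" where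
  "held_state n S a b = reduced_state n S (projector (shared_state n a b))"

text \<open>
  A quantum operation (completely positive trace-preserving map) from \<open>d\<close>-dimensional to
  \<open>d'\<close>-dimensional systems, given by Kraus operators \<open>K 0, \<dots>, K (m - 1)\<close>. The sums of matrices
  are taken entrywise.
\<close>

definition quantum_operation :: "nat \<Rightarrow> nat \<Rightarrow> (complex mat \<Rightarrow> complex mat) \<Rightarrow> bool" where
  "quantum_operation d d' \<E> \<longleftrightarrow> (\<exists>(m :: nat) K.
     (\<forall>k < m. K k \<in> carrier_mat d' d) \<and>
     mat d d (\<lambda>ij. \<Sum>k<m. (mat_adjoint (K k) * K k) $$ ij) = 1\<^sub>m d \<and>
     (\<forall>\<rho> \<in> carrier_mat d d.
        \<E> \<rho> = mat d' d' (\<lambda>ij. \<Sum>k<m. (K k * \<rho> * mat_adjoint (K k)) $$ ij)))"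

text \<open>
  The secret is unknown to the parties, so the recovery operation must not depend on
  \<open>a\<close> and \<open>b\<close>.
\<close>

definition recoverable :: "nat \<Rightarrow> nat set \<Rightarrow> bool" where
  "recoverable n S \<longleftrightarrow> (\<exists>\<E>. quantum_operation (2 ^ card S) 2 \<E> \<and>
     (\<forall>a b. (cmod a)\<^sup>2 + (cmod b)\<^sup>2 = 1 \<longrightarrow> \<E> (held_state n S a b) = projector (secret a b)))"

end

theory Submission
  imports Defs
begin

text \<open>
  Every proper subset of the parties misses some qubit \<open>p\<close>, and the digits of \<open>0\<close> and
  \<open>2 ^ n - 1\<close> at \<open>p\<close> differ, so tracing out \<open>p\<close> kills the coherences between the two branches.
  The reduced state is therefore diagonal with entries \<open>|a|\<^sup>2\<close>, \<open>|b|\<^sup>2\<close> and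
  zeros (for the empty set, it is the number \<open>|a|\<^sup>2 + |b|\<^sup>2\<close>). It does not
  see the relative phase of \<open>a\<close> and \<open>b\<close>, so no map whatsoever can send it back to both
  \<open>|0\<rangle> + |1\<rangle>\<close> and \<open>|0\<rangle> - |1\<rangle>\<close> (normalised).
\<close>

section \<open>Binary digits of basis indices\<close>

lemma nat_eq_iff_low_bits:
  fixes x y :: nat
  assumes "x < 2 ^ k" "y < 2 ^ k"
  shows "x = y \<longleftrightarrow> (\<forall>j<k. bit x j \<longleftrightarrow> bit y j)"
proof
  assume "\<forall>j<k. bit x j \<longleftrightarrow> bit y j"
  then have "take_bit k x = take_bit k y"
    by (auto simp: bit_eq_iff bit_take_bit_iff)
  with assms show "x = y"
    by (simp add: take_bit_nat_eq_self)
qed simp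

lemma bit_exp_minus_1_iff: "bit (2 ^ n - Suc 0) p \<longleftrightarrow> p < n"
  using bit_mask_iff[of n p, where 'a = nat] by (simp add: mask_eq_exp_minus_1)

lemma complex_mult_cnj_cmod: "z * cnj z = (complex_of_real (cmod z))\<^sup>2"
  using complex_norm_square[of z] by simp

lemma restricts_to_0_iff:
  assumes "x < 2 ^ card S"
  shows "restricts_to S 0 x \<longleftrightarrow> x = 0"
  using nat_eq_iff_low_bits[OF assms, of 0] by (simp add: restricts_to_def)

text \<open>Every party in \<open>S\<close> is a position below \<open>n\<close>, where
  \<open>2 ^ n - 1\<close> has digit 1, so only the all-ones index can be its part on
  \<open>S\<close>.\<close>

lemma restricts_to_exp_minus_1_iff:
  assumes "S \<subseteq> {..<n}" "x < 2 ^ card S"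
  shows "restricts_to S (2 ^ n - 1) x \<longleftrightarrow> x = 2 ^ card S - 1"
proof -
  have "finite S"
    using assms(1) finite_subset by blast
  then have "sorted_list_of_set S ! j < n" if "j < card S" for j
    using that assms(1) nth_mem[of j "sorted_list_of_set S"] by auto
  then show ?thesis
    using nat_eq_iff_low_bits[OF assms(2), of "2 ^ card S - 1"]
    by (simp add: restricts_to_def bit_exp_minus_1_iff)
qed

section \<open>Entries of the reduced state\<close>

lemma held_state_carrier [simp]:
  "held_state n S a b \<in> carrier_mat (2 ^ card S) (2 ^ card S)"
  by (simp add: held_state_def reduced_state_def)

lemma held_state_dim [simp]:
  "dim_row (held_state n S a b) = 2 ^ card S" "dim_col (held_state n S a b) = 2 ^ card S"
  by (simp_all add: held_state_def reduced_state_def)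

text \<open>The two branches contribute separately because a missing party forbids cross terms. The
  contributions are added, not nested in one conditional: for empty \<open>S\<close> the indices
  \<open>0\<close> and \<open>2 ^ card S - 1\<close> coincide and both count.\<close>

lemma held_state_index:
  assumes S: "S \<subseteq> {..<n}" "card S < n"
    and xy: "x < 2 ^ card S" "y < 2 ^ card S"
  shows "held_state n S a b $$ (x, y) =
    (if x = 0 \<and> y = 0 then a * cnj a else 0) +
    (if x = 2 ^ card S - 1 \<and> y = 2 ^ card S - 1 then b * cnj b else 0)"
proof -
  obtain p where p: "p < n" "p \<notin> S"
    using S by (metis card_lessThan lessThan_iff subsetI subset_antisym less_irrefl)
  let ?N = "2 ^ n - 1 :: nat"
  have N: "0 < ?N"
    using S(2) one_less_power[of "2 :: nat" n] by linarith
  define A where "A = {(u, v). u < (2::nat) ^ n \<and> v < (2::nat) ^ n \<and>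
    restricts_to S u x \<and> restricts_to S v y \<and> (\<forall>p \<in> {..<n} - S. bit u p \<longleftrightarrow> bit v p)}"
  define f where "f = (\<lambda>(u, v). projector (shared_state n a b) $$ (u, v))"
  have f: "f (u, v) = (if u = 0 then a else if u = ?N then b else 0) *
      cnj (if v = 0 then a else if v = ?N then b else 0)"
    if "u < 2 ^ n" "v < 2 ^ n" for u v
    using that N by (auto simp: f_def projector_def shared_state_def)
  \<comment> \<open>Members of \<open>A\<close> agree at the traced-out position \<open>p\<close>,
    where \<open>0\<close> has digit 0 and \<open>?N\<close> has digit 1.\<close>
  have diag: "u = v" if "(u, v) \<in> A" "u = 0 \<or> u = ?N" "v = 0 \<or> v = ?N" for u v
    using that p by (auto simp: A_def bit_exp_minus_1_iff)
  have "A \<subseteq> {..<2 ^ n} \<times> {..<2 ^ n}"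
    by (auto simp: A_def)
  then have "finite A"
    using finite_subset by blast
  have "held_state n S a b $$ (x, y) = sum f A"
    using xy by (simp add: held_state_def reduced_state_def A_def f_def)
  also have "\<dots> = sum f (A \<inter> {(0, 0), (?N, ?N)})"
  proof (rule sum.mono_neutral_right[OF \<open>finite A\<close>])
    show "\<forall>uv \<in> A - A \<inter> {(0, 0), (?N, ?N)}. f uv = 0"
    proof
      fix uv assume uv: "uv \<in> A - A \<inter> {(0, 0), (?N, ?N)}"
      obtain u v where [simp]: "uv = (u, v)"
        by (cases uv)
      from uv have "u < 2 ^ n" "v < 2 ^ n"
        by (auto simp: A_def)
      \<comment> \<open>Hence \<open>u\<close> or \<open>v\<close> lies off the support of the
        shared state, and one factor of \<open>f uv\<close> vanishes.\<close>
      moreover have "\<not> ((u = 0 \<or> u = ?N) \<and> (v = 0 \<or> v = ?N))"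
        using diag[of u v] uv by fastforce
      ultimately show "f uv = 0"
        using f[of u v] by auto
    qed
  qed auto
  also have "\<dots> = (\<Sum>uv \<in> {(0, 0), (?N, ?N)}. if uv \<in> A then f uv else 0)"
    by (subst Int_commute, rule sum.inter_restrict) simp
  also have "\<dots> = (if (0, 0) \<in> A then f (0, 0) else 0) + (if (?N, ?N) \<in> A then f (?N, ?N) else 0)"
    using N by (subst sum.insert) auto
  also have "(0, 0) \<in> A \<longleftrightarrow> x = 0 \<and> y = 0"
    using xy by (simp add: A_def restricts_to_0_iff)
  also have "(?N, ?N) \<in> A \<longleftrightarrow> x = 2 ^ card S - 1 \<and> y = 2 ^ card S - 1"
    using restricts_to_exp_minus_1_iff[OF S(1) xy(1)] restricts_to_exp_minus_1_iff[OF S(1) xy(2)]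
    by (simp add: A_def)
  also have "f (0, 0) = a * cnj a"
    by (simp add: f)
  also have "f (?N, ?N) = b * cnj b"
    using N by (simp add: f)
  finally show ?thesis .
qed

text \<open>For nonempty \<open>S\<close> the first and last index differ, so the two contributions
  occupy separate diagonal entries.\<close>

lemma held_state_eq_diagonal:
  assumes S: "S \<subseteq> {..<n}" "card S < n" "S \<noteq> {}"
  shows "held_state n S a b = mat (2 ^ card S) (2 ^ card S) (\<lambda>(x, y). complex_of_real
    (if x = y then (if x = 0 then (cmod a)\<^sup>2 else if x = 2 ^ card S - 1 then (cmod b)\<^sup>2 else 0)
     else 0))"
proof -
  have "0 < card S"
    using S finite_subset by (fastforce simp: card_gt_0_iff)
  then have "Suc 0 < 2 ^ card S"
    using one_less_power[of "2 :: nat" "card S"] by simp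
  with S show ?thesis
    by (intro eq_matI)
      (auto simp: held_state_index complex_mult_cnj_cmod)
qed

section \<open>Traces, adjoints and the secret as a pure state\<close>

lemma sum_two_points:
  fixes c d :: "'a :: comm_monoid_add"
  assumes "0 < N"
  shows "(\<Sum>i<Suc N. if i = 0 then c else if i = N then d else 0) = c + d"
  using assms by (simp add: sum.lessThan_Suc sum.remove[of "{..<N}" 0])

lemma mat_trace_eq_sum: "A \<in> carrier_mat d d \<Longrightarrow> mat_trace A = (\<Sum>i<d. A $$ (i, i))"
  by (simp add: mat_trace_def diag_mat_def interv_sum_list_conv_sum_set_nat atLeast0LessThan)

lemma mat_adjoint_index:
  "i < dim_col A \<Longrightarrow> j < dim_row A \<Longrightarrow> mat_adjoint A $$ (i, j) = conjugate (A $$ (j, i))"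
  by (simp add: mat_adjoint_def mat_of_rows_def)

lemma mat_adjoint_dim [simp]:
  "dim_row (mat_adjoint A) = dim_col A" "dim_col (mat_adjoint A) = dim_row A"
  by (simp_all add: mat_adjoint_def mat_of_rows_def)

lemma projector_secret_index:
  "i < 2 \<Longrightarrow> j < 2 \<Longrightarrow>
    projector (secret a b) $$ (i, j) = (if i = 0 then a else b) * cnj (if j = 0 then a else b)"
  by (auto simp: projector_def secret_def)

lemma pure_state_secret:
  assumes "(cmod a)\<^sup>2 + (cmod b)\<^sup>2 = 1"
  shows "pure_state 2 (projector (secret a b))"
proof -
  have "secret a b \<bullet>c secret a b = complex_of_real ((cmod a)\<^sup>2 + (cmod b)\<^sup>2)"
    by (simp add: secret_def scalar_prod_def complex_mult_cnj_cmod numeral_2_eq_2)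
  then show ?thesis
    using assms unfolding pure_state_def by (intro bexI[of _ "secret a b"]) (auto simp: secret_def)
qed

text \<open>Two secrets that differ only in relative phase leave \<open>S\<close> with the same
  state, so a single map would have to give both as its value there.\<close>

lemma not_recoverable:
  assumes "S \<subseteq> {..<n}" "card S < n"
  shows "\<not> recoverable n S"
proof
  assume "recoverable n S"
  then obtain \<E> where \<E>: "\<And>a b. (cmod a)\<^sup>2 + (cmod b)\<^sup>2 = 1 \<Longrightarrow>
      \<E> (held_state n S a b) = projector (secret a b)"
    unfolding recoverable_def by blast
  \<comment> \<open>This value normalises both pairs \<open>(c, c)\<close> and
    \<open>(c, - c)\<close>.\<close>
  define c where "c = complex_of_real (1 / sqrt 2)"
  have c: "(cmod c)\<^sup>2 = 1 / 2" "c * c = 1 / 2"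
    by (simp_all add: c_def norm_divide power_divide flip: of_real_mult)
  have "held_state n S c c = held_state n S c (- c)"
    using assms by (intro eq_matI) (simp_all add: held_state_index)
  then have "projector (secret c c) = projector (secret c (- c))"
    using \<E>[of c c] \<E>[of c "- c"] c by simp
  \<comment> \<open>The coherence between the basis states carries the phase: it is 1/2 for one
    secret and -1/2 for the other.\<close>
  then have "projector (secret c c) $$ (0, 1) = projector (secret c (- c)) $$ (0, 1)"
    by simp
  then show False
    using c by (simp add: projector_secret_index c_def)
qed

section \<open>Positivity and purity of the reduced state\<close>

context
  fixes n :: nat and S :: "nat set" and a b :: complex and N :: nat and h :: "nat \<Rightarrow> real"
  assumes normalised: "(cmod a)\<^sup>2 + (cmod b)\<^sup>2 = 1"
    and S: "S \<subseteq> {..<n}" "card S < n" "S \<noteq> {}"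
  defines "N \<equiv> 2 ^ card S - 1"
    and "h \<equiv> \<lambda>x. if x = 0 then (cmod a)\<^sup>2 else if x = N then (cmod b)\<^sup>2 else 0"
begin

lemma exp_card_eq: "2 ^ card S = Suc N"
  by (simp add: N_def)

lemma N_pos: "0 < N"
  using S finite_subset[OF S(1)] one_less_power[of "2 :: nat" "card S"]
  by (simp add: N_def card_gt_0_iff)

lemma held_state_eq:
  "held_state n S a b = mat (Suc N) (Suc N) (\<lambda>(x, y). if x = y then of_real (h x) else 0)"
  unfolding held_state_eq_diagonal[OF S] by (rule eq_matI) (auto simp: h_def N_def)

text \<open>Taking \<open>k = 1\<close> gives the trace and \<open>k = 2\<close> the purity. With
  \<open>0 < k\<close> the zero entries of \<open>h\<close> contribute nothing, whereas
  \<open>0 ^ 0 = 1\<close>.\<close>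

lemma sum_h_powers:
  assumes "0 < k"
  shows "(\<Sum>i<Suc N. of_real (h i) ^ k) = complex_of_real ((cmod a) ^ (2 * k) + (cmod b) ^ (2 * k))"
proof -
  have "(\<Sum>i<Suc N. of_real (h i) ^ k) = (\<Sum>i<Suc N. if i = 0 then complex_of_real ((cmod a) ^ (2 * k))
      else if i = N then complex_of_real ((cmod b) ^ (2 * k)) else 0)"
    using assms by (intro sum.cong) (auto simp: h_def power_mult)
  also have "\<dots> = complex_of_real ((cmod a) ^ (2 * k) + (cmod b) ^ (2 * k))"
    unfolding sum_two_points[OF N_pos] by simp
  finally show ?thesis .
qed

lemma mat_trace_held_state: "mat_trace (held_state n S a b) = 1"
proof -
  have "mat_trace (held_state n S a b) = (\<Sum>i<Suc N. of_real (h i) ^ 1)"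
    by (subst mat_trace_eq_sum[of _ "Suc N"]) (simp_all add: held_state_eq del: sum.lessThan_Suc)
  then show ?thesis
    using normalised by (subst (asm) sum_h_powers) simp_all
qed

text \<open>Squaring a diagonal matrix squares its diagonal entries.\<close>

lemma mat_trace_held_state_square:
  "mat_trace (held_state n S a b * held_state n S a b) = of_real ((cmod a) ^ 4 + (cmod b) ^ 4)"
proof -
  let ?H = "held_state n S a b"
  have "(?H * ?H) $$ (i, i) = of_real (h i) ^ 2" if "i < Suc N" for i
    using that
    by (simp add: held_state_eq scalar_prod_def power2_eq_square if_distrib[of "\<lambda>z. _ * z"]
        sum.delta del: sum.op_ivl_Suc cong: if_cong)
  then have "mat_trace (?H * ?H) = (\<Sum>i<Suc N. of_real (h i) ^ 2)"
    using mult_carrier_mat[of ?H "Suc N" "Suc N" ?H "Suc N"]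
    by (subst mat_trace_eq_sum[of _ "Suc N"])
      (simp_all add: exp_card_eq[symmetric] del: sum.lessThan_Suc index_mult_mat)
  then show ?thesis
    by (subst (asm) sum_h_powers) simp_all
qed

lemma density_operator_held_state: "density_operator (2 ^ card S) (held_state n S a b)"
  unfolding density_operator_def
proof (intro conjI ballI)
  let ?H = "held_state n S a b"
  show "mat_adjoint ?H = ?H"
    by (rule eq_matI) (auto simp: held_state_eq mat_adjoint_index)
  show "0 \<le> (?H *\<^sub>v v) \<bullet>c v" if "v \<in> carrier_vec (2 ^ card S)" for v
  proof -
    have [simp]: "dim_vec v = Suc N"
      using that exp_card_eq by simp
    have Hv: "(?H *\<^sub>v v) $ i = of_real (h i) * v $ i" if "i < Suc N" for i
      using that
      by (simp add: held_state_eq scalar_prod_def if_distrib[of "\<lambda>z. z * _"]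
          sum.delta del: sum.op_ivl_Suc cong: if_cong)
    have "(?H *\<^sub>v v) \<bullet>c v = (\<Sum>i<Suc N. complex_of_real (h i * (cmod (v $ i))\<^sup>2))"
      unfolding scalar_prod_def
      by (intro sum.cong) (simp_all add: Hv atLeast0LessThan complex_mult_cnj_cmod mult.assoc
          del: index_mult_mat_vec)
    \<comment> \<open>In the order on complex numbers, being nonnegative includes being real, so the
      sum is exhibited as an embedded real with nonnegative weights \<open>h i\<close>.\<close>
    also have "\<dots> = complex_of_real (\<Sum>i<Suc N. h i * (cmod (v $ i))\<^sup>2)"
      by simp
    also have "0 \<le> \<dots>"
      by (simp add: less_eq_complex_def h_def sum_nonneg del: sum.lessThan_Suc)
    finally show ?thesis .
  qed
qed (simp_all add: mat_trace_held_state)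

lemma mixed_state_held_state:
  assumes "a \<noteq> 0" "b \<noteq> 0"
  shows "mixed_state (2 ^ card S) (held_state n S a b)"
proof -
  have "\<not> pure_state (2 ^ card S) (held_state n S a b)"
  proof
    assume "pure_state (2 ^ card S) (held_state n S a b)"
    then obtain v where v: "v \<in> carrier_vec (Suc N)" "held_state n S a b = projector v"
      unfolding pure_state_def exp_card_eq by blast
    have "v $ i * cnj (v $ j) = (if i = j then of_real (h i) else 0)"
      if "i < Suc N" "j < Suc N" for i j
    proof -
      have "v $ i * cnj (v $ j) = projector v $$ (i, j)"
        using that v(1) by (simp add: projector_def)
      also have "\<dots> = (if i = j then of_real (h i) else 0)"
        using that by (simp flip: v(2) add: held_state_eq)
      finally show ?thesis .
    qed
    \<comment> \<open>The nonzero corner entries force \<open>v $ 0\<close> and \<open>v $ N\<close>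
      to be nonzero, yet the entry at \<open>(0, N)\<close> makes their product with conjugation
      vanish.\<close>
    from this[of 0 0] this[of N N] this[of 0 N] show False
      using assms N_pos by (auto simp: h_def)
  qed
  then show ?thesis
    by (simp add: mixed_state_def density_operator_held_state)
qed

end

text \<open>Squaring the normalisation shows that the purity falls short of 1 by twice the product
  of the two squares.\<close>

lemma sum_fourth_powers_less_1:
  fixes s t :: real
  assumes "s\<^sup>2 + t\<^sup>2 = 1" "s \<noteq> 0" "t \<noteq> 0"
  shows "s ^ 4 + t ^ 4 < 1"
proof -
  have "0 < s\<^sup>2 * t\<^sup>2"
    using assms by simp
  moreover have "s ^ 4 + t ^ 4 = (s\<^sup>2 + t\<^sup>2)\<^sup>2 - 2 * (s\<^sup>2 * t\<^sup>2)"
    by (simp add: power2_sum algebra_simps flip: power_mult)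
  ultimately show ?thesis
    using assms(1) by simp
qed

theorem theorem1:
  fixes n :: nat and S :: "nat set" and a b :: complex
  assumes "(cmod a)\<^sup>2 + (cmod b)\<^sup>2 = 1"
    and "S \<subseteq> {..<n}" and "card S < n"
  shows "\<not> recoverable n S \<and>
    pure_state 2 (projector (secret a b)) \<and>
    (S \<noteq> {} \<longrightarrow>
       mat_trace (held_state n S a b * held_state n S a b) =
         complex_of_real ((cmod a) ^ 4 + (cmod b) ^ 4)) \<and>
    (S \<noteq> {} \<and> a \<noteq> 0 \<and> b \<noteq> 0 \<longrightarrow>
       (cmod a) ^ 4 + (cmod b) ^ 4 < 1 \<and>
       mixed_state (2 ^ card S) (held_state n S a b))"
  using assms
  by (simp add: not_recoverable pure_state_secret mat_trace_held_state_square
      mixed_state_held_state sum_fourth_powers_less_1)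

end
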